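(* An entire function $g(z)=\sum_{n=0}^\infty a_n z^n$ belongs to $\mathcal H$ if and only if $$\sum_{n=0}^\infty \eta_n|a_n|^2<+\infty.$$
   Context: $\mathcal H$ denotes the Hörmander-Fock space: the space of entire functions $g:\mathbb C\to\mathbb C$ with $\|g\|_{\mathcal H}^2:=\frac1\pi\int_{\mathbb C}\frac{|g(z)|^2}{(1+|z|^2)^2}e^{-|z|^2}\,d\lambda(z)<\infty$, where $d\lambda$ is Lebesgue measure on $\mathbb C\cong\mathbb R^2$. For $n=0,1,2,\dots$, $\eta_n:=\int_0^{\infty}\frac{t^n}{(1+t)^2}e^{-t}\,dt$. *)

theory Defs
  imports "HOL-Analysis.Analysis"
begin

(* The squared norm takes values in ennreal, so it is defined for every Borel function,
   with the value infinity allowed; membership in the space is then finiteness. *)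
definition HF_norm_sq :: "(complex \<Rightarrow> complex) \<Rightarrow> ennreal" where
  "HF_norm_sq g = ennreal (1 / pi) *
     (\<integral>\<^sup>+ z. ennreal ((norm (g z))\<^sup>2 / (1 + (norm z)\<^sup>2)\<^sup>2 * exp (- (norm z)\<^sup>2)) \<partial>lborel)"

definition Hormander_Fock :: "(complex \<Rightarrow> complex) set" where
  "Hormander_Fock = {g. g holomorphic_on UNIV \<and> HF_norm_sq g < \<infinity>}"

definition eta :: "nat \<Rightarrow> real" where
  "eta n = (LBINT t:{0..}. t ^ n / (1 + t)\<^sup>2 * exp (- t))"

end

theory Submission
  imports Defs "HOL-Probability.Distributions"
begin

text \<open>
  Lebesgue measure on the plane is rotation invariant, so the integral of \<open>|g|\<^sup>2\<close> against a radial
  weight does not change when \<open>|g|\<^sup>2\<close> is replaced by its mean over circles, which by Parseval's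
  identity is \<open>\<Sum> |a\<^sub>n|\<^sup>2 |z|\<^bsup>2n\<^esup>\<close>. The image of Lebesgue measure under \<open>z \<mapsto> |z|\<^sup>2\<close> is \<open>\<pi>\<close> times
  Lebesgue measure on the half line, since a disc of radius \<open>\<surd>t\<close> has area \<open>\<pi> t\<close>; hence integrating
  term by term gives \<open>\<parallel>g\<parallel>\<^sup>2 = \<Sum> \<eta>\<^sub>n |a\<^sub>n|\<^sup>2\<close>, both sides possibly infinite.
\<close>

section \<open>Lebesgue measure on the plane: product form and rotation invariance\<close>

lemma borel_measurable_Complex [measurable (raw)]:
  assumes "f \<in> borel_measurable M" "g \<in> borel_measurable M"
  shows "(\<lambda>x. Complex (f x) (g x)) \<in> borel_measurable M"
  using assms by (simp add: Complex_eq)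

lemma borel_measurable_cis [measurable]: "cis \<in> borel_measurable borel"
  by (intro borel_measurable_continuous_onI continuous_intros)

lemma lborel_complex_eq_distr:
  "(lborel :: complex measure) = distr (lborel \<Otimes>\<^sub>M lborel) borel (\<lambda>(x, y). Complex x y)"
proof (rule lborel_eqI)
  fix l u :: complex
  assume "\<And>b. b \<in> Basis \<Longrightarrow> l \<bullet> b \<le> u \<bullet> b"
  from this[of 1] this[of \<i>] have le: "Re l \<le> Re u" "Im l \<le> Im u"
    by (auto simp: Basis_complex_def)
  have "(\<lambda>(x, y). Complex x y) -` box l u = {Re l<..<Re u} \<times> {Im l<..<Im u}"
    by (auto simp: in_box_complex_iff)
  then show "emeasure (distr (lborel \<Otimes>\<^sub>M lborel) borel (\<lambda>(x, y). Complex x y)) (box l u) =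
      ennreal (\<Prod>b\<in>Basis. (u - l) \<bullet> b)"
    using le
    by (subst emeasure_distr)
      (auto simp: space_pair_measure lborel.emeasure_pair_measure_Times Basis_complex_def ennreal_mult)
qed simp

text \<open>Both orders of integration are recorded because a shear must be undone in the variable
  that it moves, which has to be the inner one.\<close>

lemma nn_integral_lborel_complex:
  fixes f :: "complex \<Rightarrow> ennreal"
  assumes [measurable]: "f \<in> borel_measurable borel"
  shows "(\<integral>\<^sup>+z. f z \<partial>lborel) = (\<integral>\<^sup>+x. \<integral>\<^sup>+y. f (Complex x y) \<partial>lborel \<partial>lborel)"
    and "(\<integral>\<^sup>+z. f z \<partial>lborel) = (\<integral>\<^sup>+y. \<integral>\<^sup>+x. f (Complex x y) \<partial>lborel \<partial>lborel)"
proof -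
  have "(\<integral>\<^sup>+z. f z \<partial>lborel) = (\<integral>\<^sup>+p. f (Complex (fst p) (snd p)) \<partial>(lborel \<Otimes>\<^sub>M lborel))"
    by (subst lborel_complex_eq_distr, subst nn_integral_distr) (auto simp: case_prod_unfold)
  also have "\<dots> = (\<integral>\<^sup>+x. \<integral>\<^sup>+y. f (Complex x y) \<partial>lborel \<partial>lborel)"
    by (subst lborel.nn_integral_fst[symmetric]) auto
  finally show "(\<integral>\<^sup>+z. f z \<partial>lborel) = (\<integral>\<^sup>+x. \<integral>\<^sup>+y. f (Complex x y) \<partial>lborel \<partial>lborel)" .
  also have "\<dots> = (\<integral>\<^sup>+y. \<integral>\<^sup>+x. f (Complex x y) \<partial>lborel \<partial>lborel)"
    by (rule lborel_pair.Fubini'[symmetric]) auto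
  finally show "(\<integral>\<^sup>+z. f z \<partial>lborel) = (\<integral>\<^sup>+y. \<integral>\<^sup>+x. f (Complex x y) \<partial>lborel \<partial>lborel)" .
qed

text \<open>With the other coordinate held fixed, a shear is a translation of one real variable, so
  the inner integral does not change.\<close>

lemma nn_integral_lborel_shear:
  fixes f :: "complex \<Rightarrow> ennreal" and s :: real
  assumes [measurable]: "f \<in> borel_measurable borel"
  shows nn_integral_lborel_shear_Re: "(\<integral>\<^sup>+z. f (Complex (Re z + s * Im z) (Im z)) \<partial>lborel) = (\<integral>\<^sup>+z. f z \<partial>lborel)"
    and nn_integral_lborel_shear_Im: "(\<integral>\<^sup>+z. f (Complex (Re z) (Im z + s * Re z)) \<partial>lborel) = (\<integral>\<^sup>+z. f z \<partial>lborel)"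
proof -
  have translate: "(\<integral>\<^sup>+x. h (x + t) \<partial>lborel) = (\<integral>\<^sup>+x. h x \<partial>lborel)"
    if "h \<in> borel_measurable borel" for h :: "real \<Rightarrow> ennreal" and t
    using nn_integral_real_affine[OF that, of 1 t] by (simp add: add.commute)
  show "(\<integral>\<^sup>+z. f (Complex (Re z + s * Im z) (Im z)) \<partial>lborel) = (\<integral>\<^sup>+z. f z \<partial>lborel)"
    by (simp add: nn_integral_lborel_complex(2) translate[of "\<lambda>x. f (Complex x _)"])
  show "(\<integral>\<^sup>+z. f (Complex (Re z) (Im z + s * Re z)) \<partial>lborel) = (\<integral>\<^sup>+z. f z \<partial>lborel)"
    by (simp add: nn_integral_lborel_complex(1) translate[of "\<lambda>x. f (Complex _ x)"])
qed

text \<open>A rotation other than a half turn is a product of three shears.\<close>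

lemma nn_integral_lborel_rotate:
  fixes f :: "complex \<Rightarrow> ennreal"
  assumes [measurable]: "f \<in> borel_measurable borel" and "norm c = 1"
  shows "(\<integral>\<^sup>+z. f (c * z) \<partial>lborel) = (\<integral>\<^sup>+z. f z \<partial>lborel)"
proof -
  have non_real: "(\<integral>\<^sup>+z. f (c * z) \<partial>lborel) = (\<integral>\<^sup>+z. f z \<partial>lborel)"
    if [measurable]: "f \<in> borel_measurable borel" and c: "norm c = 1" "Im c \<noteq> 0" for f :: "complex \<Rightarrow> ennreal" and c
  proof -
    \<comment> \<open>The value is forced by comparing the matrix of the three shears with that of
      the rotation: \<open>1 + s * Im c = Re c\<close>. For \<open>c = cis \<theta>\<close> it is
      minus the tangent of \<theta>/2. The second identity below also uses that \<open>c\<close> has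
      modulus 1.\<close>
    define s where "s = (Re c - 1) / Im c"
    have "(Re c)\<^sup>2 + (Im c)\<^sup>2 = 1"
      using c(1) by (metis cmod_power2 power_one)
    then have s: "s * Im c = Re c - 1" "s * (1 + Re c) = - Im c"
      using c(2) by (auto simp: s_def field_simps power2_eq_square)
    define S where "S z = Complex (Re z + s * Im z) (Im z)" for z
    define T where "T z = Complex (Re z) (Im z + Im c * Re z)" for z
    have "S (T (S z)) = c * z" for z
    proof (rule complex_eqI)
      have "Re (S (T (S z))) = Re z + (s * Im c) * Re z + s * (1 + (1 + s * Im c)) * Im z"
        by (simp add: S_def T_def algebra_simps)
      also have "1 + (1 + s * Im c) = 1 + Re c"
        using s by simp
      also have "Re z + (s * Im c) * Re z + s * (1 + Re c) * Im z = Re (c * z)"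
        unfolding s by (simp add: algebra_simps)
      finally show "Re (S (T (S z))) = Re (c * z)" .
      have "Im (S (T (S z))) = Im z + Im c * Re z + (s * Im c) * Im z"
        by (simp add: S_def T_def algebra_simps)
      also have "\<dots> = Im (c * z)"
        unfolding s by (simp add: algebra_simps)
      finally show "Im (S (T (S z))) = Im (c * z)" .
    qed
    then have "(\<integral>\<^sup>+z. f (c * z) \<partial>lborel) = (\<integral>\<^sup>+z. f (S (T (S z))) \<partial>lborel)"
      by simp
    also have "\<dots> = (\<integral>\<^sup>+z. f z \<partial>lborel)"
      using nn_integral_lborel_shear_Re[of "\<lambda>z. f (S (T z))" s] nn_integral_lborel_shear_Im[of "\<lambda>z. f (S z)" "Im c"]
        nn_integral_lborel_shear_Re[of f s]
      by (simp add: S_def T_def)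
    finally show ?thesis .
  qed
  show ?thesis
  proof (cases "Im c = 0")
    case True
    \<comment> \<open>Here \<open>c\<close> is 1 or -1, where \<open>s\<close> would divide by zero.
      Both factors \<open>\<i>\<close> and \<open>- \<i> * c\<close> are non-real of modulus 1, so
      the shear argument applies to each.\<close>
    have "c * z = \<i> * ((- \<i> * c) * z)" for z
      by (simp add: mult.assoc[symmetric])
    then have "(\<integral>\<^sup>+z. f (c * z) \<partial>lborel) = (\<integral>\<^sup>+z. f (\<i> * ((- \<i> * c) * z)) \<partial>lborel)"
      by simp
    also have "\<dots> = (\<integral>\<^sup>+z. f (\<i> * z) \<partial>lborel)"
      using True assms(2) by (intro non_real) (auto simp: norm_mult cmod_def)
    also have "\<dots> = (\<integral>\<^sup>+z. f z \<partial>lborel)"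
      by (intro non_real) auto
    finally show ?thesis .
  qed (use assms non_real in auto)
qed

text \<open>The integral over the plane is the same for every rotation angle, so averaging it over
  an interval of length 1 leaves it unchanged; Tonelli then moves the average inside.\<close>

lemma nn_integral_lborel_circle_mean:
  fixes f :: "complex \<Rightarrow> ennreal"
  assumes [measurable]: "f \<in> borel_measurable borel"
  shows "(\<integral>\<^sup>+z. f z \<partial>lborel) =
    (\<integral>\<^sup>+z. (\<integral>\<^sup>+t. f (cis (2 * pi * t) * z) * indicator {0..1} t \<partial>lborel) \<partial>lborel)"
proof -
  have "(\<integral>\<^sup>+z. (\<integral>\<^sup>+t. f (cis (2 * pi * t) * z) * indicator {0..1} t \<partial>lborel) \<partial>lborel) =
      (\<integral>\<^sup>+t. (\<integral>\<^sup>+z. f (cis (2 * pi * t) * z) * indicator {0..1} t \<partial>lborel) \<partial>lborel)"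
    by (rule lborel_pair.Fubini'[symmetric]) auto
  also have "\<dots> = (\<integral>\<^sup>+t. (\<integral>\<^sup>+z. f z \<partial>lborel) * indicator {0..1::real} t \<partial>lborel)"
    by (simp add: nn_integral_multc nn_integral_lborel_rotate)
  also have "\<dots> = (\<integral>\<^sup>+z. f z \<partial>lborel)"
    by (simp add: nn_integral_cmult_indicator)
  finally show ?thesis ..
qed

section \<open>Integration of radial functions\<close>

lemma distr_lborel_norm_square_complex:
  "distr (lborel :: complex measure) borel (\<lambda>z. (norm z)\<^sup>2) =
    density lborel (\<lambda>t. ennreal pi * indicator {0..} t)"
proof (rule measure_eqI_generator_eq)
  \<comment> \<open>Closed lower half-lines are stable under intersection, generate the Borel sets
    and exhaust the line with finite measure, so two measures that agree on them are equal.\<close>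
  let ?E = "range (\<lambda>a::real. {..a})"
  let ?D = "distr (lborel :: complex measure) borel (\<lambda>z. (norm z)\<^sup>2)"
  have D: "emeasure ?D {..a} = ennreal (pi * max 0 a)" for a :: real
  proof (cases "a \<ge> 0")
    case True
    then have "(norm z)\<^sup>2 \<le> a \<longleftrightarrow> norm z \<le> sqrt a" for z :: complex
      by (metis norm_ge_zero real_sqrt_le_iff real_sqrt_abs abs_of_nonneg)
    then have "(\<lambda>z::complex. (norm z)\<^sup>2) -` {..a} = cball 0 (sqrt a)"
      by auto
    with True show ?thesis
      by (simp add: emeasure_distr emeasure_cball unit_ball_vol_2)
  next
    case False
    then have "(\<lambda>z::complex. (norm z)\<^sup>2) -` {..a} = {}"
      using order_trans[OF zero_le_power2] by fastforce
    with False show ?thesis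
      by (simp add: emeasure_distr)
  qed
  show "Int_stable ?E"
    by (auto simp: Int_stable_def)
  show "emeasure ?D X = emeasure (density lborel (\<lambda>t. ennreal pi * indicator {0..} t)) X"
    if "X \<in> ?E" for X
  proof -
    from that obtain a where X: "X = {..a}" by auto
    have "emeasure (density lborel (\<lambda>t. ennreal pi * indicator {0..} t)) X =
        (\<integral>\<^sup>+t. ennreal pi * indicator {0..a} t \<partial>lborel)"
      unfolding X by (subst emeasure_density) (auto intro!: nn_integral_cong split: split_indicator)
    also have "\<dots> = ennreal (pi * max 0 a)"
      by (cases "0 \<le> a") (auto simp: nn_integral_cmult_indicator ennreal_mult)
    finally show ?thesis
      by (simp add: X D)
  qed
  show "range (\<lambda>n::nat. {..real n}) \<subseteq> ?E" "(\<Union>n::nat. {..real n}) = UNIV"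
    by (auto simp: real_arch_simple)
  show "emeasure ?D {..real n} \<noteq> \<infinity>" for n
    by (simp add: D)
qed (auto simp: borel_eq_atMost)

lemma nn_integral_lborel_complex_radial:
  fixes f :: "real \<Rightarrow> ennreal"
  assumes [measurable]: "f \<in> borel_measurable borel"
  shows "(\<integral>\<^sup>+z. f ((norm (z::complex))\<^sup>2) \<partial>lborel) = ennreal pi * (\<integral>\<^sup>+t. f t * indicator {0..} t \<partial>lborel)"
proof -
  have "(\<integral>\<^sup>+z. f ((norm (z::complex))\<^sup>2) \<partial>lborel) =
      (\<integral>\<^sup>+t. f t \<partial>distr (lborel :: complex measure) borel (\<lambda>z. (norm z)\<^sup>2))"
    by (subst nn_integral_distr) auto
  also have "\<dots> = (\<integral>\<^sup>+t. ennreal pi * (f t * indicator {0..} t) \<partial>lborel)"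
    unfolding distr_lborel_norm_square_complex
    by (subst nn_integral_density) (auto simp: mult_ac)
  also have "\<dots> = ennreal pi * (\<integral>\<^sup>+t. f t * indicator {0..} t \<partial>lborel)"
    by (rule nn_integral_cmult) auto
  finally show ?thesis .
qed

section \<open>Parseval's identity on circles\<close>

lemma has_integral_cis_period:
  fixes k :: int
  shows "((\<lambda>t. cis (2 * pi * k * t)) has_integral (if k = 0 then 1 else 0)) {0..1}"
proof (cases "k = 0")
  case True
  then show ?thesis
    using has_integral_const_real[of "1::complex" 0 1] by simp
next
  case False
  \<comment> \<open>The antiderivative has period 1 in \<open>t\<close>, so its two boundary values
    cancel.\<close>
  have "((\<lambda>t. cis (2 * pi * k * t)) has_integral
      cis (2 * pi * k * 1) / (\<i> * (2 * pi * k)) - cis (2 * pi * k * 0) / (\<i> * (2 * pi * k))) {0..1}"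
  proof (intro fundamental_theorem_of_calculus)
    fix t :: real assume "t \<in> {0..1}"
    show "((\<lambda>t. cis (2 * pi * k * t) / (\<i> * (2 * pi * k))) has_vector_derivative cis (2 * pi * k * t)) (at t within {0..1})"
    proof -
      have "((\<lambda>t. exp (\<i> * (2 * pi * k) * of_real t) / (\<i> * (2 * pi * k))) has_vector_derivative
          exp (\<i> * (2 * pi * k) * of_real t)) (at t within {0..1})"
        by (rule has_vector_derivative_real_field) (use False in \<open>auto intro!: derivative_eq_intros\<close>)
      then show ?thesis
        by (simp add: cis_conv_exp mult.assoc)
    qed
  qed simp
  moreover have "cis (2 * pi * k) = 1"
    by (rule cis_multiple_2pi) simp
  ultimately show ?thesis
    using False by simp
qed

text \<open>For partial sums the identity is orthogonality of the exponentials. Absolute summability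
  bounds all partial sums by one constant, which is integrable on the unit interval, so dominated
  convergence passes to the limit.\<close>

lemma Parseval_absolutely_summable:
  fixes b :: "nat \<Rightarrow> complex" and G :: "real \<Rightarrow> complex"
  assumes b: "summable (\<lambda>n. norm (b n))"
    and G: "\<And>t. (\<lambda>n. b n * cis (2 * pi * n * t)) sums G t"
  shows "(\<lambda>t. (norm (G t))\<^sup>2) integrable_on {0..1}"
    and "(\<lambda>n. (norm (b n))\<^sup>2) sums integral {0..1} (\<lambda>t. (norm (G t))\<^sup>2)"
proof -
  define S where "S N t = (\<Sum>n<N. b n * cis (2 * pi * n * t))" for N t
  have partial: "((\<lambda>t. (norm (S N t))\<^sup>2) has_integral (\<Sum>n<N. (norm (b n))\<^sup>2)) {0..1}" for N
  proof -
    \<comment> \<open>Expanding \<open>S N t * cnj (S N t)\<close> gives integer frequencies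
      \<open>n - m\<close>; after integration only the diagonal survives. The computation is
      complex, and \<open>Re\<close> brings the result back to the reals.\<close>
    have eq: "complex_of_real ((norm (S N t))\<^sup>2) =
        (\<Sum>n<N. \<Sum>m<N. b n * cnj (b m) * cis (2 * pi * (int n - int m) * t))" for t
    proof -
      have "cis (2 * pi * n * t) * cnj (cis (2 * pi * m * t)) = cis (2 * pi * (int n - int m) * t)" for n m :: nat
        by (simp add: cis_cnj cis_mult algebra_simps)
      moreover have "b n * c * cnj (b m * d) = b n * cnj (b m) * (c * cnj d)" for n m c d
        by (simp add: mult_ac)
      ultimately have "b n * cis (2 * pi * n * t) * cnj (b m * cis (2 * pi * m * t)) =
          b n * cnj (b m) * cis (2 * pi * (int n - int m) * t)" for n m
        by (simp only:)
      then show ?thesis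
        unfolding complex_norm_square S_def cnj_sum sum_product by (simp only:)
    qed
    have "((\<lambda>t. \<Sum>n<N. \<Sum>m<N. b n * cnj (b m) * cis (2 * pi * (int n - int m) * t)) has_integral
        (\<Sum>n<N. \<Sum>m<N. b n * cnj (b m) * (if int n - int m = 0 then 1 else 0))) {0..1}"
      by (intro has_integral_sum has_integral_mult_right has_integral_cis_period) auto
    also have "(\<Sum>n<N. \<Sum>m<N. b n * cnj (b m) * (if int n - int m = 0 then 1 else 0)) =
        complex_of_real (\<Sum>n<N. (norm (b n))\<^sup>2)"
      by (simp add: if_distrib cong: if_cong flip: complex_norm_square)
    finally have "((\<lambda>t. complex_of_real ((norm (S N t))\<^sup>2)) has_integral
        complex_of_real (\<Sum>n<N. (norm (b n))\<^sup>2)) {0..1}"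
      by (simp only: eq)
    from has_integral_linear[OF this bounded_linear_Re] show ?thesis
      by (simp only: o_def Re_complex_of_real)
  qed
  have lim: "(\<lambda>N. (norm (S N t))\<^sup>2) \<longlonglongrightarrow> (norm (G t))\<^sup>2" for t
    using G[of t] by (auto simp: sums_def S_def intro!: tendsto_intros)
  have bound: "norm ((norm (S N t))\<^sup>2) \<le> (\<Sum>n. norm (b n))\<^sup>2" for N t
  proof -
    have "norm (S N t) \<le> (\<Sum>n<N. norm (b n))"
      unfolding S_def by (rule order_trans[OF norm_sum]) (simp add: norm_mult)
    also have "\<dots> \<le> (\<Sum>n. norm (b n))"
      by (rule sum_le_suminf[OF b]) auto
    finally show ?thesis
      by (simp add: power_mono)
  qed
  note dc = dominated_convergence[of "\<lambda>N t. (norm (S N t))\<^sup>2" "{0..1}" "\<lambda>_. (\<Sum>n. norm (b n))\<^sup>2",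
      OF _ _ bound lim]
  show "(\<lambda>t. (norm (G t))\<^sup>2) integrable_on {0..1}"
    by (rule dc(1)) (use partial in auto)
  have "(\<lambda>N. integral {0..1} (\<lambda>t. (norm (S N t))\<^sup>2)) \<longlonglongrightarrow> integral {0..1} (\<lambda>t. (norm (G t))\<^sup>2)"
    by (rule dc(2)) (use partial in auto)
  then show "(\<lambda>n. (norm (b n))\<^sup>2) sums integral {0..1} (\<lambda>t. (norm (G t))\<^sup>2)"
    by (simp only: sums_def integral_unique[OF partial])
qed

lemma nn_integral_circle_power_series:
  fixes g :: "complex \<Rightarrow> complex" and a :: "nat \<Rightarrow> complex"
  assumes g: "\<And>z. (\<lambda>n. a n * z ^ n) sums g z"
    and [measurable]: "g \<in> borel_measurable borel"
  shows "(\<integral>\<^sup>+t. ennreal ((norm (g (cis (2 * pi * t) * z)))\<^sup>2) * indicator {0..1} t \<partial>lborel) =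
    (\<Sum>n. ennreal ((norm (a n))\<^sup>2 * ((norm z)\<^sup>2) ^ n))"
proof -
  \<comment> \<open>Convergence at any point of modulus larger than \<open>norm z\<close> forces
    absolute convergence at \<open>z\<close>.\<close>
  have "summable (\<lambda>n. a n * (of_real (norm z + 1)) ^ n)"
    using g sums_summable by blast
  then have abs: "summable (\<lambda>n. norm (a n * z ^ n))"
    by (rule powser_insidea) simp
  have rot: "(\<lambda>n. a n * z ^ n * cis (2 * pi * n * t)) sums g (cis (2 * pi * t) * z)" for t
  proof -
    have "cis (2 * pi * t) ^ n = cis (2 * pi * n * t)" for n
      by (simp add: Complex.DeMoivre mult_ac)
    then have "a n * (cis (2 * pi * t) * z) ^ n = a n * z ^ n * cis (2 * pi * n * t)" for n
      by (simp add: power_mult_distrib)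
    with g[of "cis (2 * pi * t) * z"] show ?thesis
      by simp
  qed
  note P = Parseval_absolutely_summable[OF abs rot]
  let ?I = "integral {0..1} (\<lambda>t. (norm (g (cis (2 * pi * t) * z)))\<^sup>2)"
  \<comment> \<open>Nonnegativity turns the gauge integral from Parseval into a nonnegative Lebesgue
    integral.\<close>
  have "(\<integral>\<^sup>+t. ennreal ((norm (g (cis (2 * pi * t) * z)))\<^sup>2) * indicator {0..1} t \<partial>lborel) = ennreal ?I"
    using nn_integral_has_integral_lebesgue[OF _ integrable_integral[OF P(1)]]
    by (simp add: nn_integral_completion ennreal_mult ennreal_indicator mult.commute)
  also have "\<dots> = ennreal (\<Sum>n. (norm (a n * z ^ n))\<^sup>2)"
    using sums_unique[OF P(2)] by simp
  also have "\<dots> = (\<Sum>n. ennreal ((norm (a n * z ^ n))\<^sup>2))"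
    by (rule suminf_ennreal2[symmetric]) (use P(2) sums_summable in auto)
  also have "\<dots> = (\<Sum>n. ennreal ((norm (a n))\<^sup>2 * ((norm z)\<^sup>2) ^ n))"
    by (simp add: norm_mult norm_power power_mult_distrib power_mult[symmetric] mult.commute)
  finally show ?thesis .
qed

section \<open>The moments of the weight and the norm formula\<close>

lemma ennreal_eta:
  "ennreal (eta n) = (\<integral>\<^sup>+t. ennreal (t ^ n / (1 + t)\<^sup>2 * exp (- t)) * indicator {0..} t \<partial>lborel)"
proof -
  let ?f = "\<lambda>t::real. indicator {0..} t * (t ^ n / (1 + t)\<^sup>2 * exp (- t))"
  \<comment> \<open>A Bochner integral defaults to 0 when the integrand is not integrable.
    Domination by the integrand of the Gamma integral for \<open>fact n\<close> excludes this, so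
    \<open>eta n\<close> is the true moment.\<close>
  have le: "t ^ n / (1 + t)\<^sup>2 * exp (- t) \<le> t ^ n * exp (- t)" if "t \<ge> 0" for t :: real
  proof -
    have "t ^ n * 1 \<le> t ^ n * (1 + t)\<^sup>2"
      using that by (intro mult_left_mono one_le_power) auto
    with that show ?thesis
      by (intro mult_right_mono) (auto simp: divide_le_eq)
  qed
  have nonneg: "0 \<le> ?f t" for t
    by (auto split: split_indicator)
  have "(\<integral>\<^sup>+t. ennreal (?f t) \<partial>lborel) \<le> (\<integral>\<^sup>+t. ennreal (t ^ n * exp (- t)) * indicator {0..} t \<partial>lborel)"
    using le by (intro nn_integral_mono) (auto split: split_indicator intro!: ennreal_leI)
  also have "\<dots> < \<infinity>"
    by (simp add: nn_intergal_power_times_exp_Ici)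
  finally have "integrable lborel ?f"
    using nonneg by (intro integrableI_nonneg) auto
  then have "(\<integral>\<^sup>+t. ennreal (?f t) \<partial>lborel) = ennreal (eta n)"
    using nonneg by (subst nn_integral_eq_integral) (auto simp: eta_def set_lebesgue_integral_def)
  moreover have "ennreal (?f t) = ennreal (t ^ n / (1 + t)\<^sup>2 * exp (- t)) * indicator {0..} t" for t
    by (simp split: split_indicator)
  ultimately show ?thesis
    by simp
qed

lemma eta_nonneg: "0 \<le> eta n"
  unfolding eta_def set_lebesgue_integral_def
  by (intro Bochner_Integration.integral_nonneg) (auto split: split_indicator)

lemma HF_norm_sq_power_series:
  fixes g :: "complex \<Rightarrow> complex" and a :: "nat \<Rightarrow> complex"
  assumes g: "\<And>z. (\<lambda>n. a n * z ^ n) sums g z"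
    and [measurable]: "g \<in> borel_measurable borel"
  shows "HF_norm_sq g = (\<Sum>n. ennreal (eta n * (norm (a n))\<^sup>2))"
proof -
  \<comment> \<open>The weight of the space as a function of the squared modulus, so that
    \<open>t ^ n * w t\<close> is the integrand of \<open>eta n\<close>.\<close>
  define w :: "real \<Rightarrow> real" where "w t = exp (- t) / (1 + t)\<^sup>2" for t
  have [measurable]: "w \<in> borel_measurable borel" and w: "0 \<le> w t" for t
    by (auto simp: w_def[abs_def])
  have moment: "(\<integral>\<^sup>+z. ennreal (((norm (z::complex))\<^sup>2) ^ n * w ((norm z)\<^sup>2)) \<partial>lborel) =
      ennreal pi * ennreal (eta n)" for n
    using nn_integral_lborel_complex_radial[of "\<lambda>t. ennreal (t ^ n * w t)"]
    by (simp add: ennreal_eta w_def)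
  have "(\<integral>\<^sup>+z. ennreal ((norm (g z))\<^sup>2 / (1 + (norm z)\<^sup>2)\<^sup>2 * exp (- (norm z)\<^sup>2)) \<partial>lborel) =
      (\<integral>\<^sup>+z. ennreal (w ((norm z)\<^sup>2)) * ennreal ((norm (g z))\<^sup>2) \<partial>lborel)"
    by (simp add: w_def ennreal_mult'[symmetric] mult_ac)
  also have "\<dots> = (\<integral>\<^sup>+z. ennreal (w ((norm z)\<^sup>2)) *
      (\<integral>\<^sup>+t. ennreal ((norm (g (cis (2 * pi * t) * z)))\<^sup>2) * indicator {0..1} t \<partial>lborel) \<partial>lborel)"
    \<comment> \<open>A rotation preserves the modulus, so the weight is constant on each circle and
      comes out of the circle mean.\<close>
    by (subst nn_integral_lborel_circle_mean)
      (simp_all add: norm_mult mult.assoc nn_integral_cmult)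
  also have "\<dots> = (\<integral>\<^sup>+z. (\<Sum>n. ennreal ((norm (a n))\<^sup>2) *
      ennreal (((norm (z::complex))\<^sup>2) ^ n * w ((norm z)\<^sup>2))) \<partial>lborel)"
    unfolding nn_integral_circle_power_series[OF assms] ennreal_suminf_cmult[symmetric]
    by (simp add: ennreal_mult[symmetric] w mult_ac)
  \<comment> \<open>All terms are nonnegative, so sum and integral may be exchanged even when the
    value is infinite.\<close>
  also have "\<dots> = (\<Sum>n. ennreal ((norm (a n))\<^sup>2) *
      (\<integral>\<^sup>+z. ennreal (((norm (z::complex))\<^sup>2) ^ n * w ((norm z)\<^sup>2)) \<partial>lborel))"
    by (simp add: nn_integral_suminf nn_integral_cmult)
  also have "\<dots> = (\<Sum>n. ennreal ((norm (a n))\<^sup>2) * (ennreal pi * ennreal (eta n)))"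
    by (simp only: moment)
  also have "\<dots> = ennreal pi * (\<Sum>n. ennreal (eta n * (norm (a n))\<^sup>2))"
    unfolding ennreal_suminf_cmult[symmetric] by (simp add: ennreal_mult eta_nonneg mult_ac)
  finally have "HF_norm_sq g = ennreal (1 / pi) * (ennreal pi * (\<Sum>n. ennreal (eta n * (norm (a n))\<^sup>2)))"
    unfolding HF_norm_sq_def by (rule arg_cong)
  also have "\<dots> = (ennreal (1 / pi) * ennreal pi) * (\<Sum>n. ennreal (eta n * (norm (a n))\<^sup>2))"
    by (rule mult.assoc[symmetric])
  also have "ennreal (1 / pi) * ennreal pi = 1"
    by (subst ennreal_mult'[symmetric]) auto
  finally show ?thesis
    by simp
qed

theorem proposition3p22:
  fixes g :: "complex \<Rightarrow> complex" and a :: "nat \<Rightarrow> complex"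
  assumes "g holomorphic_on UNIV"
    and "\<And>z. (\<lambda>n. a n * z ^ n) sums g z"
  shows "g \<in> Hormander_Fock \<longleftrightarrow> summable (\<lambda>n. eta n * (norm (a n))\<^sup>2)"
proof -
  have "g \<in> borel_measurable borel"
    using assms(1) by (intro borel_measurable_continuous_onI holomorphic_on_imp_continuous_on)
  then have norm_sq: "HF_norm_sq g = (\<Sum>n. ennreal (eta n * (norm (a n))\<^sup>2))"
    by (rule HF_norm_sq_power_series[OF assms(2)])
  have nonneg: "0 \<le> eta n * (norm (a n))\<^sup>2" for n
    by (simp add: eta_nonneg)
  \<comment> \<open>For nonnegative real terms, a finite sum in \<open>ennreal\<close> is the same
    as summability in the reals.\<close>
  have "HF_norm_sq g < \<infinity> \<longleftrightarrow> summable (\<lambda>n. eta n * (norm (a n))\<^sup>2)"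
    unfolding norm_sq infinity_ennreal_def less_top[symmetric]
    using summable_suminf_not_top[OF nonneg] ennreal_suminf_neq_top[OF _ nonneg]
    by (intro iffI) simp_all
  then show ?thesis
    using assms(1) by (simp add: Hormander_Fock_def)
qed

end
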